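(* There are constants $C,C',C''>0$ such that for every sufficiently large $n$ there is a triangle-free graph on $n$ vertices with all degrees between $C'n^{1/3}$ and $C''n^{1/3}$ that contains no semi-bipartite induced subgraph of average degree (with respect to its semi-bipartition) at least $C\log n$.
   Context: $\log$ is the natural logarithm. Given a graph $G$, an induced subgraph $G'$ of $G$ with vertex set $V'$ is semi-bipartite if it admits a partition $V'=V_1\cup V_2$ such that $V_1$ is a stable set of $G$; its average degree with respect to this semi-bipartition is the average degree of the bipartite graph on $V_1\cup V_2$ formed by the edges of $G$ between $V_1$ and $V_2$ (edges inside $V_2$ are ignored). A semi-bipartite induced subgraph of average degree at least $x$ means one admitting some semi-bipartition with respect to which its average degree is at least $x$. *)

theory Defs
  imports Complex_Main "Graph_Theory.Digraph_Component"
begin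

text \<open>
  Finite simple graphs are the symmetric, loop-free digraphs without parallel arcs of
  Graph_Theory (\<^locale>\<open>pair_graph\<close>); an undirected edge is a pair of opposite arcs, so the
  degree of a vertex is its \<^const>\<open>out_degree\<close>.
\<close>

definition triangle_free :: "('a, 'b) pre_digraph \<Rightarrow> bool" where
  "triangle_free G \<longleftrightarrow>
     \<not> (\<exists>u v w. u \<rightarrow>\<^bsub>G\<^esub> v \<and> v \<rightarrow>\<^bsub>G\<^esub> w \<and> w \<rightarrow>\<^bsub>G\<^esub> u)"

definition stable_set :: "('a, 'b) pre_digraph \<Rightarrow> 'a set \<Rightarrow> bool" where
  "stable_set G S \<longleftrightarrow> S \<subseteq> verts G \<and> (\<forall>u\<in>S. \<forall>v\<in>S. \<not> u \<rightarrow>\<^bsub>G\<^esub> v)"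

definition semi_bipartition ::
  "('a, 'b) pre_digraph \<Rightarrow> ('a, 'b) pre_digraph \<Rightarrow> 'a set \<Rightarrow> 'a set \<Rightarrow> bool" where
  "semi_bipartition G H V1 V2 \<longleftrightarrow>
     verts H = V1 \<union> V2 \<and> V1 \<inter> V2 = {} \<and> stable_set G V1"

definition bipartite_between ::
  "('a, 'b) pre_digraph \<Rightarrow> 'a set \<Rightarrow> 'a set \<Rightarrow> 'a pair_pre_digraph" where
  "bipartite_between G V1 V2 =
     \<lparr> pverts = V1 \<union> V2,
       parcs = {(u, v). u \<rightarrow>\<^bsub>G\<^esub> v \<and> (u \<in> V1 \<and> v \<in> V2 \<or> u \<in> V2 \<and> v \<in> V1)} \<rparr>"

text \<open>The graph without vertices gets average degree \<open>0\<close>, as \<open>0 / 0 = 0\<close>.\<close>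

definition average_degree :: "('a, 'b) pre_digraph \<Rightarrow> real" where
  "average_degree G = (\<Sum>v\<in>verts G. real (out_degree G v)) / real (card (verts G))"

definition has_semi_bipartite_induced_subgraph ::
  "('a, 'b) pre_digraph \<Rightarrow> real \<Rightarrow> bool" where
  "has_semi_bipartite_induced_subgraph G x \<longleftrightarrow>
     (\<exists>H V1 V2. induced_subgraph H G \<and> semi_bipartition G H V1 V2 \<and>
        average_degree (with_proj (bipartite_between G V1 V2)) \<ge> x)"

end

theory Submission
  imports Defs "HOL-Library.Ramsey" "HOL-Probability.Product_PMF" "HOL-Real_Asymp.Real_Asymp"
begin

text \<open>
  Let \<open>r = n powr (1/3)\<close> and take a random graph on \<open>n\<close> vertices with edge probability
  \<open>p = 1 / (8 * r\<^sup>2)\<close>. With overwhelming probability all degrees are at most \<open>r\<close>, every stable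
  set has at most \<open>4 * ln n / p + 1\<close> vertices, and between any set \<open>A\<close> of at most that size and
  any set \<open>B\<close> there are at most \<open>40 * ln n * (card A + card B)\<close> edges. Since the expected number
  of edges minus \<open>r\<close> times the number of triangles is of order \<open>r ^ 4\<close>, some such graph still
  has order \<open>r ^ 4\<close> edges after one vertex of each triangle is deleted. Passing to an induced
  subgraph of minimum degree of order \<open>r\<close> keeps a positive fraction of the vertices, because the
  maximum degree is at most \<open>r\<close>; the edge bounds for stable sets are inherited by induced subgraphs.
  Finally, replacing each vertex by boundedly many twins restores exactly \<open>n\<close> vertices and changes
  all quantities only by constant factors.
\<close>

section \<open>Random subsets of a finite set\<close>

definition random_subset :: "'a set \<Rightarrow> real \<Rightarrow> 'a set pmf" where
  "random_subset E p = map_pmf (\<lambda>w. {e \<in> E. w e}) (Pi_pmf E False (\<lambda>_. bernoulli_pmf p))"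

lemma set_pmf_random_subset: "set_pmf (random_subset E p) \<subseteq> Pow E"
  by (auto simp: random_subset_def)

lemma integrable_random_subset [simp]:
  fixes f :: "'a set \<Rightarrow> real"
  assumes "finite E"
  shows "integrable (measure_pmf (random_subset E p)) f"
  using assms finite_subset[OF set_pmf_random_subset] by (intro integrable_measure_pmf_finite) auto

lemma expectation_prod_random_subset:
  fixes f :: "'a \<Rightarrow> bool \<Rightarrow> real"
  assumes "finite E" "0 \<le> p" "p \<le> 1" "\<And>e b. 0 \<le> f e b"
  shows "measure_pmf.expectation (random_subset E p) (\<lambda>F. \<Prod>e\<in>E. f e (e \<in> F)) =
         (\<Prod>e\<in>E. p * f e True + (1 - p) * f e False)"
proof -
  have "measure_pmf.expectation (random_subset E p) (\<lambda>F. \<Prod>e\<in>E. f e (e \<in> F)) =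
        measure_pmf.expectation (Pi_pmf E False (\<lambda>_. bernoulli_pmf p)) (\<lambda>w. \<Prod>e\<in>E. f e (w e))"
    by (simp add: random_subset_def)
  also have "\<dots> = (\<Prod>e\<in>E. measure_pmf.expectation (bernoulli_pmf p) (f e))"
    using assms by (intro expectation_prod_Pi_pmf) (auto intro: integrable_measure_pmf_finite)
  finally show ?thesis
    using assms by (simp add: mult.commute)
qed

lemma prob_random_subset_superset:
  assumes "finite E" "S \<subseteq> E" "0 \<le> p" "p \<le> 1"
  shows "measure_pmf.prob (random_subset E p) {F. S \<subseteq> F} = p ^ card S"
proof -
  have indicator_eq:
    "indicator {F. S \<subseteq> F} F = (\<Prod>e\<in>E. if e \<in> S then of_bool (e \<in> F) else 1 :: real)" for F
    using assms by (auto simp: indicator_def intro!: prod.neutral prod_zero)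
  have "measure_pmf.prob (random_subset E p) {F. S \<subseteq> F} =
      measure_pmf.expectation (random_subset E p) (indicator {F. S \<subseteq> F})"
    by simp
  also have "\<dots> = measure_pmf.expectation (random_subset E p)
      (\<lambda>F. \<Prod>e\<in>E. if e \<in> S then of_bool (e \<in> F) else 1)"
    by (intro Bochner_Integration.integral_cong refl indicator_eq)
  also have "\<dots> = (\<Prod>e\<in>E. if e \<in> S then p else 1)"
    using assms by (subst expectation_prod_random_subset) (auto intro!: prod.cong)
  also have "\<dots> = p ^ card S"
    using assms by (simp add: prod.If_cases Int_absorb1)
  finally show ?thesis .
qed

lemma expectation_power_card_random_subset:
  assumes "finite E" "S \<subseteq> E" "0 \<le> p" "p \<le> 1" "0 \<le> y"
  shows "measure_pmf.expectation (random_subset E p) (\<lambda>F. y ^ card (S \<inter> F)) =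
         (1 + p * (y - 1)) ^ card S"
proof -
  have "y ^ card (S \<inter> F) = (\<Prod>e\<in>E. if e \<in> S \<and> e \<in> F then y else 1)" for F
  proof -
    have "E \<inter> {e. e \<in> S \<and> e \<in> F} = S \<inter> F"
      using assms by auto
    then show ?thesis
      using assms by (simp add: prod.If_cases)
  qed
  then have "measure_pmf.expectation (random_subset E p) (\<lambda>F. y ^ card (S \<inter> F)) =
      (\<Prod>e\<in>E. p * (if e \<in> S then y else 1) + (1 - p))"
    using assms expectation_prod_random_subset[of E p "\<lambda>e b. if e \<in> S \<and> b then y else 1"]
    by simp
  also have "\<dots> = (\<Prod>e\<in>E. if e \<in> S then 1 + p * (y - 1) else 1)"
    by (intro prod.cong) (auto simp: algebra_simps)
  also have "\<dots> = (1 + p * (y - 1)) ^ card S"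
    using assms by (simp add: prod.If_cases Int_absorb1)
  finally show ?thesis .
qed

lemma expectation_power_card_random_subset_le:
  assumes "finite E" "S \<subseteq> E" "0 \<le> p" "p \<le> 1" "0 \<le> y"
  shows "measure_pmf.expectation (random_subset E p) (\<lambda>F. y ^ card (S \<inter> F))
         \<le> exp (p * (y - 1) * card S)"
proof -
  have "0 \<le> (1 - p) + p * y"
    using assms by (intro add_nonneg_nonneg mult_nonneg_nonneg) auto
  then have "(1 + p * (y - 1)) ^ card S \<le> exp (p * (y - 1)) ^ card S"
    by (intro power_mono exp_ge_add_one_self) (simp add: algebra_simps)
  also have "\<dots> = exp (p * (y - 1) * card S)"
    by (simp add: mult.commute flip: exp_of_nat_mult)
  finally show ?thesis
    using assms by (simp add: expectation_power_card_random_subset)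
qed

lemma prob_random_subset_disjoint_le:
  assumes "finite E" "S \<subseteq> E" "0 \<le> p" "p \<le> 1"
  shows "measure_pmf.prob (random_subset E p) {F. S \<inter> F = {}} \<le> exp (- p * card S)"
proof -
  have "finite S"
    using assms finite_subset by blast
  then have indicator_eq: "indicator {F. S \<inter> F = {}} F = (0::real) ^ card (S \<inter> F)" for F
    by (simp add: indicator_def power_0_left)
  have "measure_pmf.prob (random_subset E p) {F. S \<inter> F = {}} =
      measure_pmf.expectation (random_subset E p) (indicator {F. S \<inter> F = {}})"
    by simp
  also have "\<dots> = measure_pmf.expectation (random_subset E p) (\<lambda>F. 0 ^ card (S \<inter> F))"
    by (intro Bochner_Integration.integral_cong refl indicator_eq)
  also have "\<dots> \<le> exp (- p * card S)"
    using expectation_power_card_random_subset_le[OF assms, of 0] by simp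
  finally show ?thesis .
qed

lemma prob_random_subset_card_ge_le:
  fixes x :: real
  assumes "finite E" "S \<subseteq> E" "0 \<le> p" "p \<le> 1" and x: "exp 2 * p * card S \<le> x"
  shows "measure_pmf.prob (random_subset E p) {F. x \<le> card (S \<inter> F)} \<le> exp (- x)"
proof -
  let ?M = "random_subset E p" and ?f = "\<lambda>F. exp 2 ^ card (S \<inter> F) :: real"
  have "exp (2 * x) \<le> ?f F \<longleftrightarrow> x \<le> card (S \<inter> F)" for F
    by (simp flip: exp_of_nat_mult)
  then have "measure_pmf.prob ?M {F. x \<le> card (S \<inter> F)} =
      measure_pmf.prob ?M {F. exp (2 * x) \<le> ?f F}"
    by simp
  also have "\<dots> \<le> measure_pmf.expectation ?M ?f / exp (2 * x)"
    using integral_Markov_inequality_measure[of ?M ?f "{}" "exp (2 * x)"] assms by simp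
  also have "\<dots> \<le> exp (p * (exp 2 - 1) * card S) / exp (2 * x)"
    using assms by (intro divide_right_mono expectation_power_card_random_subset_le) auto
  also have "\<dots> \<le> exp x / exp (2 * x)"
  proof -
    have "p * (exp 2 - 1) * card S \<le> exp 2 * p * card S"
      using assms by (simp add: algebra_simps)
    then show ?thesis
      using x by (intro divide_right_mono) auto
  qed
  also have "\<dots> = exp (- x)"
    by (simp flip: exp_diff)
  finally show ?thesis .
qed

lemma expectation_card_Collect:
  assumes "finite T"
  shows "measure_pmf.expectation M (\<lambda>F. real (card {t \<in> T. Q t F})) =
         (\<Sum>t\<in>T. measure_pmf.prob M {F. Q t F})"
proof -
  have "real (card {t \<in> T. Q t F}) = (\<Sum>t\<in>T. indicator {F. Q t F} F)" for F
    using assms by (simp add: indicator_def sum.If_cases Int_def)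
  then show ?thesis
    by (simp add: measure_pmf.emeasure_eq_measure)
qed

lemma exists_outside_event_gt:
  fixes X :: "'a \<Rightarrow> real"
  assumes int: "integrable (measure_pmf M) X" and le: "\<And>\<omega>. \<omega> \<in> set_pmf M \<Longrightarrow> X \<omega> \<le> m"
    and gt: "t + (m - t) * measure_pmf.prob M B < measure_pmf.expectation M X"
  shows "\<exists>\<omega>\<in>set_pmf M - B. t < X \<omega>"
proof (rule ccontr)
  assume "\<not> ?thesis"
  then have "X \<omega> \<le> t + (m - t) * indicator B \<omega>" if "\<omega> \<in> set_pmf M" for \<omega>
    using le that by (cases "\<omega> \<in> B") (auto simp: not_less)
  then have "measure_pmf.expectation M X \<le>
      measure_pmf.expectation M (\<lambda>\<omega>. t + (m - t) * indicator B \<omega>)"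
    using int by (intro integral_mono_AE)
      (auto simp: AE_measure_pmf_iff measure_pmf.emeasure_eq_measure)
  also have "\<dots> = t + (m - t) * measure_pmf.prob M B"
    by (subst Bochner_Integration.integral_add) (auto simp: measure_pmf.emeasure_eq_measure)
  finally show False
    using gt by simp
qed

lemma sum_power_card_Pow:
  fixes q :: "'a::comm_semiring_1"
  assumes "finite V"
  shows "(\<Sum>A\<in>Pow V. q ^ card A) = (1 + q) ^ card V"
  using prod_add[OF assms, of "\<lambda>_. q" "\<lambda>_. 1"] by (simp add: add.commute)

lemma sum_power_card_nonempty_le:
  fixes q :: real
  assumes "finite V" "0 \<le> q" "card V * q \<le> 1"
  shows "(\<Sum>A\<in>Pow V - {{}}. q ^ card A) \<le> 2 * card V * q"
proof -
  have "(\<Sum>A\<in>Pow V - {{}}. q ^ card A) = (1 + q) ^ card V - 1"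
    using assms by (simp add: sum_diff1 sum_power_card_Pow)
  also have "\<dots> \<le> exp q ^ card V - 1"
    using assms by (intro diff_right_mono power_mono exp_ge_add_one_self) auto
  also have "\<dots> = exp (card V * q) - 1"
    by (simp add: exp_of_nat_mult)
  also have "\<dots> \<le> card V * q + (card V * q)\<^sup>2"
    using assms exp_bound[of "card V * q"] by simp
  also have "\<dots> \<le> 2 * card V * q"
    using assms mult_left_mono[of "card V * q" 1 "card V * q"]
    by (simp add: power2_eq_square mult_ac)
  finally show ?thesis .
qed

lemma prob_exists_nonempty_subset_le:
  fixes q :: real
  assumes "finite V" "0 \<le> q" "card V * q \<le> 1"
    and Q: "\<And>A. A \<subseteq> V \<Longrightarrow> measure_pmf.prob M {\<omega>. Q A \<omega>} \<le> q ^ card A"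
  shows "measure_pmf.prob M {\<omega>. \<exists>A\<subseteq>V. A \<noteq> {} \<and> Q A \<omega>} \<le> 2 * card V * q"
proof -
  have "{\<omega>. \<exists>A\<subseteq>V. A \<noteq> {} \<and> Q A \<omega>} = (\<Union>A\<in>Pow V - {{}}. {\<omega>. Q A \<omega>})"
    by auto
  then have "measure_pmf.prob M {\<omega>. \<exists>A\<subseteq>V. A \<noteq> {} \<and> Q A \<omega>}
      \<le> (\<Sum>A\<in>Pow V - {{}}. measure_pmf.prob M {\<omega>. Q A \<omega>})"
    using assms by (auto intro!: measure_pmf.finite_measure_subadditive_finite)
  also have "\<dots> \<le> (\<Sum>A\<in>Pow V - {{}}. q ^ card A)"
    using Q by (intro sum_mono) auto
  also have "\<dots> \<le> 2 * card V * q"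
    using assms by (intro sum_power_card_nonempty_le)
  finally show ?thesis .
qed

lemma prob_exists_nonempty_subset_pair_le:
  fixes q :: real
  assumes "finite V" "0 \<le> q" "card V * q \<le> 1"
    and Q: "\<And>A B. A \<subseteq> V \<Longrightarrow> B \<subseteq> V \<Longrightarrow>
      measure_pmf.prob M {\<omega>. Q A B \<omega>} \<le> q ^ card A * q ^ card B"
  shows "measure_pmf.prob M {\<omega>. \<exists>A\<subseteq>V. \<exists>B\<subseteq>V. A \<noteq> {} \<and> B \<noteq> {} \<and> Q A B \<omega>}
         \<le> (2 * card V * q)\<^sup>2"
proof -
  let ?N = "Pow V - {{}}"
  have "{\<omega>. \<exists>A\<subseteq>V. \<exists>B\<subseteq>V. A \<noteq> {} \<and> B \<noteq> {} \<and> Q A B \<omega>} =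
      (\<Union>z\<in>?N \<times> ?N. {\<omega>. Q (fst z) (snd z) \<omega>})"
    by (simp only: set_eq_iff UN_iff mem_Collect_eq Bex_def split_paired_Ex mem_Sigma_iff fst_conv
        snd_conv Diff_iff Pow_iff) blast
  then have "measure_pmf.prob M {\<omega>. \<exists>A\<subseteq>V. \<exists>B\<subseteq>V. A \<noteq> {} \<and> B \<noteq> {} \<and> Q A B \<omega>}
      \<le> (\<Sum>z\<in>?N \<times> ?N. measure_pmf.prob M {\<omega>. Q (fst z) (snd z) \<omega>})"
    using assms by (auto intro!: measure_pmf.finite_measure_subadditive_finite)
  also have "\<dots> \<le> (\<Sum>z\<in>?N \<times> ?N. q ^ card (fst z) * q ^ card (snd z))"
    using Q by (intro sum_mono) auto
  also have "\<dots> = (\<Sum>A\<in>?N. q ^ card A)\<^sup>2"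
    by (simp add: power2_eq_square sum_product sum.cartesian_product case_prod_unfold)
  also have "\<dots> \<le> (2 * card V * q)\<^sup>2"
    using assms by (intro power_mono sum_power_card_nonempty_le sum_nonneg) auto
  finally show ?thesis .
qed

lemma prob_random_subset_mono:
  assumes "\<And>F. F \<subseteq> E \<Longrightarrow> P F \<Longrightarrow> Q F"
  shows "measure_pmf.prob (random_subset E p) {F. P F} \<le>
         measure_pmf.prob (random_subset E p) {F. Q F}"
  using assms set_pmf_random_subset[of E p]
  by (intro measure_pmf.finite_measure_mono_AE) (auto simp: AE_measure_pmf_iff)

section \<open>Edge sets\<close>

definition vertex_degree :: "'a set set \<Rightarrow> 'a \<Rightarrow> nat" where
  "vertex_degree F v = card {e \<in> F. v \<in> e}"

definition cross_edges :: "'a set set \<Rightarrow> 'a set \<Rightarrow> 'a set \<Rightarrow> 'a set set" where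
  "cross_edges F A B = {e \<in> F. \<exists>a\<in>A. \<exists>b\<in>B. e = {a, b}}"

definition triangles :: "'a set \<Rightarrow> 'a set set \<Rightarrow> 'a set set" where
  "triangles V F = {t \<in> [V]\<^bsup>3\<^esup>. [t]\<^bsup>2\<^esup> \<subseteq> F}"

definition stable_sparse :: "real \<Rightarrow> 'a set \<Rightarrow> 'a set set \<Rightarrow> bool" where
  "stable_sparse c V F \<longleftrightarrow> (\<forall>A\<subseteq>V. \<forall>B\<subseteq>V. [A]\<^bsup>2\<^esup> \<inter> F = {} \<longrightarrow>
     real (card (cross_edges F A B)) \<le> c * (card A + card B))"

lemma card_nsets:
  assumes "finite A"
  shows "card ([A]\<^bsup>k\<^esup>) = card A choose k"
proof -
  have "[A]\<^bsup>k\<^esup> = {N. N \<subseteq> A \<and> card N = k}"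
    using assms finite_subset by (auto simp: nsets_def)
  then show ?thesis
    using n_subsets[OF assms] by simp
qed

lemma real_choose_two: "real (n choose 2) = (real n - 1) * n / 2"
  by (cases n) (auto simp: choose_two real_of_nat_div algebra_simps)

lemma card_neighbours_eq_vertex_degree:
  assumes "F \<subseteq> [V]\<^bsup>2\<^esup>"
  shows "card {u. {u, v} \<in> F} = vertex_degree F v"
  unfolding vertex_degree_def
proof (rule bij_betw_same_card[of "\<lambda>u. {u, v}"], unfold bij_betw_def, intro conjI)
  show "inj_on (\<lambda>u. {u, v}) {u. {u, v} \<in> F}"
    by (auto simp: inj_on_def doubleton_eq_iff)
  have "\<exists>u. e = {u, v}" if e: "e \<in> F" "v \<in> e" for e
  proof -
    have "e \<in> [V]\<^bsup>2\<^esup>"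
      using e assms by blast
    then obtain a b where "e = {a, b}"
      by (rule nsets2_E)
    then show ?thesis
      using e(2) by auto
  qed
  then show "(\<lambda>u. {u, v}) ` {u. {u, v} \<in> F} = {e \<in> F. v \<in> e}"
    by auto
qed

lemma vertex_degree_nsets_le:
  assumes "finite V"
  shows "vertex_degree ([V]\<^bsup>2\<^esup>) v \<le> card V"
proof -
  have "card {u. {u, v} \<in> [V]\<^bsup>2\<^esup>} \<le> card V"
    using assms by (intro card_mono) auto
  then show ?thesis
    by (simp only: card_neighbours_eq_vertex_degree[OF order.refl])
qed

lemma card_cross_edges_le:
  assumes "finite A" "finite B"
  shows "card (cross_edges F A B) \<le> card A * card B"
proof -
  have "cross_edges F A B \<subseteq> (\<lambda>(a, b). {a, b}) ` (A \<times> B)"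
    by (auto simp: cross_edges_def)
  then show ?thesis
    using surj_card_le[of "A \<times> B"] assms by (auto simp: card_cartesian_product)
qed

section \<open>Bad events in the random graph\<close>

abbreviation random_graph :: "'a set \<Rightarrow> real \<Rightarrow> 'a set set pmf" where
  "random_graph V p \<equiv> random_subset ([V]\<^bsup>2\<^esup>) p"

lemma prob_vertex_degree_ge_le:
  fixes p x :: real
  assumes "finite V" "0 \<le> p" "p \<le> 1" "exp 2 * p * card V \<le> x"
  shows "measure_pmf.prob (random_graph V p) {F. x \<le> vertex_degree F v} \<le> exp (- x)"
proof -
  let ?S = "{e \<in> [V]\<^bsup>2\<^esup>. v \<in> e}"
  have "vertex_degree F v = card (?S \<inter> F)" if "F \<subseteq> [V]\<^bsup>2\<^esup>" for F
    unfolding vertex_degree_def using that by (intro arg_cong[of _ _ card]) auto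
  then have "measure_pmf.prob (random_graph V p) {F. x \<le> vertex_degree F v} \<le>
      measure_pmf.prob (random_graph V p) {F. x \<le> card (?S \<inter> F)}"
    by (intro prob_random_subset_mono) simp
  also have "\<dots> \<le> exp (- x)"
  proof (rule prob_random_subset_card_ge_le)
    have "exp 2 * p * card ?S \<le> exp 2 * p * card V"
      using assms vertex_degree_nsets_le[of V v]
      by (intro mult_left_mono) (auto simp: vertex_degree_def)
    then show "exp 2 * p * card ?S \<le> x"
      using assms by linarith
  qed (use assms in \<open>auto simp: finite_imp_finite_nsets\<close>)
  finally show ?thesis .
qed

lemma prob_exists_vertex_degree_ge_le:
  fixes p x :: real
  assumes "finite V" "0 \<le> p" "p \<le> 1" "exp 2 * p * card V \<le> x"
  shows "measure_pmf.prob (random_graph V p) {F. \<exists>v\<in>V. x \<le> vertex_degree F v} \<le> card V * exp (- x)"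
proof -
  have "{F. \<exists>v\<in>V. x \<le> vertex_degree F v} = (\<Union>v\<in>V. {F. x \<le> vertex_degree F v})"
    by auto
  then have "measure_pmf.prob (random_graph V p) {F. \<exists>v\<in>V. x \<le> vertex_degree F v}
      \<le> (\<Sum>v\<in>V. measure_pmf.prob (random_graph V p) {F. x \<le> vertex_degree F v})"
    using assms(1) by (auto intro!: measure_pmf.finite_measure_subadditive_finite)
  also have "\<dots> \<le> (\<Sum>v\<in>V. exp (- x))"
    using assms by (intro sum_mono prob_vertex_degree_ge_le)
  finally show ?thesis by simp
qed

lemma prob_large_stable_le:
  fixes p x :: real
  assumes "finite V" "0 < p" "p \<le> 1" "A \<subseteq> V" "2 * x / p + 1 \<le> card A"
  shows "measure_pmf.prob (random_graph V p) {F. [A]\<^bsup>2\<^esup> \<inter> F = {}} \<le> exp (- x) ^ card A"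
proof -
  have "finite A"
    using assms finite_subset by blast
  then have card_pairs: "real (card ([A]\<^bsup>2\<^esup>)) = (real (card A) - 1) * card A / 2"
    by (simp add: card_nsets real_choose_two)
  have "2 * x \<le> p * (real (card A) - 1)"
    using assms by (simp add: field_simps)
  then have "2 * x * card A / 2 \<le> p * (real (card A) - 1) * card A / 2"
    by (intro divide_right_mono mult_right_mono) auto
  then have "x * card A \<le> p * card ([A]\<^bsup>2\<^esup>)"
    unfolding card_pairs by simp
  have "measure_pmf.prob (random_graph V p) {F. [A]\<^bsup>2\<^esup> \<inter> F = {}} \<le> exp (- p * card ([A]\<^bsup>2\<^esup>))"
    using assms
    by (intro prob_random_subset_disjoint_le) (auto simp: finite_imp_finite_nsets nsets_mono)
  also have "\<dots> \<le> exp (card A * - x)"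
    using \<open>x * card A \<le> p * card ([A]\<^bsup>2\<^esup>)\<close> by (simp add: mult.commute)
  finally show ?thesis
    by (simp only: exp_of_nat_mult)
qed

lemma prob_exists_large_stable_le:
  fixes p x :: real
  assumes "finite V" "0 < p" "p \<le> 1" "0 \<le> x" "card V * exp (- x) \<le> 1"
  shows "measure_pmf.prob (random_graph V p) {F. \<exists>A\<subseteq>V. 2 * x / p + 1 \<le> card A \<and> [A]\<^bsup>2\<^esup> \<inter> F = {}}
         \<le> 2 * card V * exp (- x)"
proof -
  let ?Q = "\<lambda>A F. 2 * x / p + 1 \<le> card A \<and> [A]\<^bsup>2\<^esup> \<inter> F = {}"
  have "0 \<le> 2 * x / p"
    using assms by simp
  then have "\<not> ?Q {} F" for F
    by simp
  then have "measure_pmf.prob (random_graph V p) {F. \<exists>A\<subseteq>V. ?Q A F} \<le>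
      measure_pmf.prob (random_graph V p) {F. \<exists>A\<subseteq>V. A \<noteq> {} \<and> ?Q A F}"
    by (intro prob_random_subset_mono) blast
  also have "\<dots> \<le> 2 * card V * exp (- x)"
  proof (intro prob_exists_nonempty_subset_le)
    show "measure_pmf.prob (random_graph V p) {F. ?Q A F} \<le> exp (- x) ^ card A" if "A \<subseteq> V" for A
      using prob_large_stable_le[OF assms(1-3) that, of x] by (cases "2 * x / p + 1 \<le> card A") auto
  qed (use assms in auto)
  finally show ?thesis .
qed

lemma prob_many_cross_edges_le:
  fixes p x :: real
  assumes "finite V" "0 \<le> p" "p \<le> 1" "A \<subseteq> V" "B \<subseteq> V" "exp 2 * p * card A \<le> x"
  shows "measure_pmf.prob (random_graph V p) {F. x * (card A + card B) \<le> card (cross_edges F A B)}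
         \<le> exp (- x) ^ card A * exp (- x) ^ card B"
proof -
  let ?S = "cross_edges ([V]\<^bsup>2\<^esup>) A B"
  have fin: "finite A" "finite B"
    using assms finite_subset by blast+
  have "0 \<le> exp 2 * p * card A"
    using assms by simp
  then have "0 \<le> x"
    using assms by linarith
  have "cross_edges F A B = ?S \<inter> F" if "F \<subseteq> [V]\<^bsup>2\<^esup>" for F
    using that by (auto simp: cross_edges_def)
  then have "measure_pmf.prob (random_graph V p)
        {F. x * (card A + card B) \<le> card (cross_edges F A B)}
      \<le> measure_pmf.prob (random_graph V p) {F. x * (card A + card B) \<le> card (?S \<inter> F)}"
    by (intro prob_random_subset_mono) metis
  also have "\<dots> \<le> exp (- (x * (card A + card B)))"
  proof (rule prob_random_subset_card_ge_le)
    have "exp 2 * p * card ?S \<le> exp 2 * p * (card A * card B)"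
      using assms fin by (intro mult_left_mono of_nat_mono card_cross_edges_le) auto
    also have "\<dots> \<le> x * card B"
      using mult_right_mono[OF assms(6), of "card B"] by (simp add: mult.assoc)
    also have "\<dots> \<le> x * (card A + card B)"
      using \<open>0 \<le> x\<close> by (intro mult_left_mono) auto
    finally show "exp 2 * p * card ?S \<le> x * (card A + card B)" .
  qed (use assms in \<open>auto simp: finite_imp_finite_nsets cross_edges_def\<close>)
  also have "\<dots> = exp (- x) ^ card A * exp (- x) ^ card B"
    by (simp add: algebra_simps flip: exp_of_nat_mult exp_add)
  finally show ?thesis .
qed

lemma prob_exists_many_cross_edges_le:
  fixes V :: "'a set" and p s x :: real
  assumes "finite V" "0 \<le> p" "p \<le> 1" "card V * exp (- x) \<le> 1" and s: "exp 2 * p * s \<le> x"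
  shows "measure_pmf.prob (random_graph V p) {F. \<exists>A\<subseteq>V. \<exists>B\<subseteq>V. card A < s \<and>
           x * (card A + card B) < card (cross_edges F A B)} \<le> (2 * card V * exp (- x))\<^sup>2"
proof -
  let ?P = "\<lambda>(A :: 'a set) B F. card A < s \<and> x * (card A + card B) < card (cross_edges F A B)"
  let ?Q = "\<lambda>(A :: 'a set) B F. card A < s \<and> x * (card A + card B) \<le> card (cross_edges F A B)"
  have small: "exp 2 * p * card A \<le> x" if "card A < s" for A :: "'a set"
    using that assms(2) by (intro order_trans[OF mult_left_mono s]) auto
  have "A \<noteq> {} \<and> B \<noteq> {} \<and> ?Q A B F" if "?P A B F" for A B F
  proof -
    have "0 \<le> exp 2 * p * card A"
      using assms(2) by simp
    then have "0 \<le> x * (card A + card B)"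
      using small[of A] that by (intro mult_nonneg_nonneg) auto
    then have "cross_edges F A B \<noteq> {}"
      using that by auto
    then show ?thesis
      using that by (auto simp: cross_edges_def)
  qed
  then have "measure_pmf.prob (random_graph V p) {F. \<exists>A\<subseteq>V. \<exists>B\<subseteq>V. ?P A B F} \<le>
      measure_pmf.prob (random_graph V p) {F. \<exists>A\<subseteq>V. \<exists>B\<subseteq>V. A \<noteq> {} \<and> B \<noteq> {} \<and> ?Q A B F}"
    by (intro prob_random_subset_mono) blast
  also have "\<dots> \<le> (2 * card V * exp (- x))\<^sup>2"
  proof (intro prob_exists_nonempty_subset_pair_le)
    fix A B assume "A \<subseteq> V" "B \<subseteq> V"
    then show "measure_pmf.prob (random_graph V p) {F. ?Q A B F}
        \<le> exp (- x) ^ card A * exp (- x) ^ card B"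
      using prob_many_cross_edges_le[OF assms(1-3), of A B x] small[of A]
      by (cases "card A < s") auto
  qed (use assms in auto)
  finally show ?thesis .
qed

lemma not_stable_sparse_cases:
  fixes c s :: real
  assumes "\<not> stable_sparse c V F"
  obtains (large_stable) A where "A \<subseteq> V" "s \<le> card A" "[A]\<^bsup>2\<^esup> \<inter> F = {}"
    | (dense_cross) A B where "A \<subseteq> V" "B \<subseteq> V" "card A < s"
        "c * (card A + card B) < card (cross_edges F A B)"
proof -
  obtain A B where AB: "A \<subseteq> V" "B \<subseteq> V" "[A]\<^bsup>2\<^esup> \<inter> F = {}"
      "c * (card A + card B) < card (cross_edges F A B)"
    using assms by (auto simp: stable_sparse_def not_le)
  show thesis
  proof (cases "s \<le> card A")
    case True
    then show thesis
      using large_stable AB by blast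
  next
    case False
    then show thesis
      using dense_cross[of A B] AB by simp
  qed
qed

lemma prob_not_stable_sparse_le:
  fixes p x y :: real
  assumes V: "finite V" and p: "0 < p" "p \<le> 1" and x: "0 \<le> x" "card V * exp (- x) \<le> 1"
    and y: "exp 2 * (2 * x + p) \<le> y"
  shows "measure_pmf.prob (random_graph V p) {F. \<not> stable_sparse y V F} \<le> 6 * card V * exp (- x)"
proof -
  let ?prob = "measure_pmf.prob (random_graph V p)"
  define s where "s = 2 * x / p + 1"
  let ?large_stable = "{F. \<exists>A\<subseteq>V. s \<le> card A \<and> [A]\<^bsup>2\<^esup> \<inter> F = {}}"
  let ?dense = "{F. \<exists>A\<subseteq>V. \<exists>B\<subseteq>V. card A < s \<and> y * (card A + card B) < card (cross_edges F A B)}"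
  have s: "exp 2 * p * s \<le> y"
    using y p by (simp add: s_def algebra_simps)
  have "2 * x + p \<le> exp 2 * (2 * x + p)"
    using x p mult_right_mono[of 1 "exp 2" "2 * x + p"] by simp
  then have "x \<le> y"
    using x p y by linarith
  then have exp_y: "card V * exp (- y) \<le> card V * exp (- x)"
    by (intro mult_left_mono) auto
  have "F \<in> ?large_stable \<union> ?dense" if "\<not> stable_sparse y V F" for F
    using that by (cases rule: not_stable_sparse_cases[where s = s]) blast+
  then have "{F. \<not> stable_sparse y V F} \<subseteq> ?large_stable \<union> ?dense"
    by blast
  then have "?prob {F. \<not> stable_sparse y V F} \<le> ?prob ?large_stable + ?prob ?dense"
    by (intro order_trans[OF measure_pmf.finite_measure_mono measure_Un_le]) auto
  also have "\<dots> \<le> 2 * card V * exp (- x) + (2 * card V * exp (- y))\<^sup>2"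
    using V p x(2) exp_y s prob_exists_large_stable_le[OF V p x]
    by (intro add_mono prob_exists_many_cross_edges_le) (auto simp: s_def)
  also have "(2 * card V * exp (- y))\<^sup>2 \<le> (2 * card V * exp (- x))\<^sup>2"
    using exp_y by (intro power_mono) auto
  also have "(2 * card V * exp (- x))\<^sup>2 \<le> 4 * card V * exp (- x)"
    using mult_left_mono[OF x(2), of "4 * card V * exp (- x)"]
    by (simp add: power2_eq_square mult_ac)
  finally show ?thesis by simp
qed

section \<open>A sparse edge set with many edges and few triangles\<close>

lemma expectation_edges_minus_triangles:
  fixes p c :: real
  assumes "finite V" "0 \<le> p" "p \<le> 1"
  shows "measure_pmf.expectation (random_graph V p) (\<lambda>F. card F - c * card (triangles V F)) =
         (card V choose 2) * p - c * ((card V choose 3) * p ^ 3)"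
proof -
  let ?M = "random_graph V p"
  have fin: "finite ([V]\<^bsup>k\<^esup>)" for k
    using assms by (simp add: finite_imp_finite_nsets)
  have pairs: "card {e \<in> [V]\<^bsup>2\<^esup>. {e} \<subseteq> F} = card F" if "F \<in> set_pmf ?M" for F
    using that set_pmf_random_subset by (intro arg_cong[of _ _ card]) blast
  have "measure_pmf.expectation ?M (\<lambda>F. real (card F)) =
      measure_pmf.expectation ?M (\<lambda>F. real (card {e \<in> [V]\<^bsup>2\<^esup>. {e} \<subseteq> F}))"
    by (intro integral_cong_AE) (auto simp: AE_measure_pmf_iff pairs simp del: insert_subset)
  also have "\<dots> = (\<Sum>e\<in>[V]\<^bsup>2\<^esup>. measure_pmf.prob ?M {F. {e} \<subseteq> F})"
    by (intro expectation_card_Collect fin)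
  also have "\<dots> = (\<Sum>e\<in>[V]\<^bsup>2\<^esup>. p)"
    using assms fin by (intro sum.cong refl, subst prob_random_subset_superset) auto
  finally have edges: "measure_pmf.expectation ?M (\<lambda>F. real (card F)) = (card V choose 2) * p"
    using assms by (simp add: card_nsets)
  have "measure_pmf.expectation ?M (\<lambda>F. real (card (triangles V F))) =
      (\<Sum>t\<in>[V]\<^bsup>3\<^esup>. measure_pmf.prob ?M {F. [t]\<^bsup>2\<^esup> \<subseteq> F})"
    unfolding triangles_def by (intro expectation_card_Collect fin)
  also have "\<dots> = (\<Sum>t\<in>[V]\<^bsup>3\<^esup>. p ^ 3)"
  proof (intro sum.cong refl)
    fix t assume "t \<in> [V]\<^bsup>3\<^esup>"
    then have "[t]\<^bsup>2\<^esup> \<subseteq> [V]\<^bsup>2\<^esup>" "card ([t]\<^bsup>2\<^esup>) = 3"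
      by (auto simp: nsets_def card_nsets[unfolded nsets_def] choose_two)
    then show "measure_pmf.prob ?M {F. [t]\<^bsup>2\<^esup> \<subseteq> F} = p ^ 3"
      using assms fin by (simp add: prob_random_subset_superset)
  qed
  also have "\<dots> = (card V choose 3) * p ^ 3"
    using assms by (simp add: card_nsets)
  finally show ?thesis
    using edges fin by (subst Bochner_Integration.integral_diff) auto
qed

lemma edges_minus_triangles_le:
  fixes c :: real
  assumes "finite V" "F \<subseteq> [V]\<^bsup>2\<^esup>" "0 \<le> c"
  shows "card F - c * card (triangles V F) \<le> real (card V) ^ 2"
proof -
  have "card F \<le> card ([V]\<^bsup>2\<^esup>)"
    using assms by (intro card_mono finite_imp_finite_nsets)
  also have "\<dots> \<le> card V ^ 2"
    using assms(1) binomial_le_pow[of 2 "card V"]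
    by (cases "2 \<le> card V") (auto simp: card_nsets binomial_eq_0)
  finally have "real (card F) \<le> real (card V) ^ 2"
    by (metis of_nat_le_iff of_nat_power)
  moreover have "0 \<le> c * card (triangles V F)"
    using assms(3) by simp
  ultimately show ?thesis by linarith
qed

lemma choose_2_minus_choose_3_ge:
  fixes p r :: real
  assumes n: "real n = r ^ 3" "2 \<le> n" and r: "0 < r" and p: "p = 1 / (8 * r\<^sup>2)"
  shows "r ^ 4 / 48 \<le> (n choose 2) * p - r * ((n choose 3) * p ^ 3)"
proof -
  have "real n ^ 2 / 4 \<le> n choose 2"
    using n(2) by (simp add: real_choose_two power2_eq_square field_simps)
  then have "real n ^ 2 / 4 * p \<le> (n choose 2) * p"
    using p by (intro mult_right_mono) auto
  moreover have "real n ^ 2 / 4 * p = r ^ 4 / 32"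
    using r unfolding n p by (simp add: field_simps eval_nat_numeral)
  moreover have "real (n choose 3) \<le> real n ^ 3 / 6"
    using binomial_fact_pow[of n 3] by (simp add: fact_numeral flip: of_nat_power of_nat_mult)
  then have "r * ((n choose 3) * p ^ 3) \<le> r * (real n ^ 3 / 6 * p ^ 3)"
    using p r by (intro mult_left_mono mult_right_mono) auto
  moreover have "r * (real n ^ 3 / 6 * p ^ 3) = r ^ 4 / 3072"
    using r unfolding n p by (simp add: field_simps eval_nat_numeral)
  moreover have "0 \<le> r ^ 4"
    using r by simp
  ultimately show ?thesis by linarith
qed

lemma exp_2_le_8: "exp 2 \<le> (8 :: real)"
proof -
  have "exp (2 * 1) = exp (1 :: real) ^ 2"
    by (rule exp_double)
  also have "\<dots> \<le> (272 / 100) ^ 2"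
    using e_less_272 by (intro power_mono) auto
  finally show ?thesis
    by (simp add: power2_eq_square)
qed

lemma prob_large_degree_or_not_stable_sparse_le:
  fixes p r :: real
  assumes V: "finite V" "1 \<le> ln (card V)" and p: "0 < p" "p \<le> 1" and r: "8 * (p * card V) \<le> r"
  shows "measure_pmf.prob (random_graph V p)
           {F. (\<exists>v\<in>V. r \<le> vertex_degree F v) \<or> \<not> stable_sparse (40 * ln (card V)) V F}
         \<le> card V * exp (- r) + 6 / card V"
proof -
  let ?prob = "measure_pmf.prob (random_graph V p)" and ?L = "ln (real (card V))"
  have "0 < card V"
    using V(2) by (cases "card V") auto
  then have exp_L: "card V * exp (- 2 * ?L) = 1 / card V"
    by (simp add: exp_minus exp_double field_simps power2_eq_square)
  have "exp 2 * (p * card V) \<le> 8 * (p * card V)"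
    using exp_2_le_8 p by (intro mult_right_mono) auto
  also have "\<dots> \<le> r"
    by (rule r)
  finally have degree: "?prob {F. \<exists>v\<in>V. r \<le> vertex_degree F v} \<le> card V * exp (- r)"
    using V p by (intro prob_exists_vertex_degree_ge_le) (auto simp: mult.assoc)
  have "exp 2 * (2 * (2 * ?L) + p) \<le> 8 * (5 * ?L)"
    using exp_2_le_8 p V(2) by (intro mult_mono) auto
  then have "?prob {F. \<not> stable_sparse (40 * ?L) V F} \<le> 6 * card V * exp (- (2 * ?L))"
    using V p exp_L \<open>0 < card V\<close> by (intro prob_not_stable_sparse_le) auto
  then have sparse: "?prob {F. \<not> stable_sparse (40 * ?L) V F} \<le> 6 / card V"
    using exp_L by simp
  have "{F. (\<exists>v\<in>V. r \<le> vertex_degree F v) \<or> \<not> stable_sparse (40 * ?L) V F} =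
      {F. \<exists>v\<in>V. r \<le> vertex_degree F v} \<union> {F. \<not> stable_sparse (40 * ?L) V F}"
    by blast
  then show ?thesis
    using degree sparse measure_Un_le[of "{F. \<exists>v\<in>V. r \<le> vertex_degree F v}" "random_graph V p"
        "{F. \<not> stable_sparse (40 * ?L) V F}"] by simp
qed

lemma exists_sparse_edge_set:
  fixes r :: real
  assumes V: "finite V" "2 \<le> card V" and n: "real (card V) = r ^ 3"
    and r: "1 \<le> r" "1 \<le> ln (card V)"
    and small: "real (card V) ^ 2 * (card V * exp (- r) + 6 / card V) < r ^ 4 / 192"
  shows "\<exists>F\<subseteq>[V]\<^bsup>2\<^esup>. (\<forall>v\<in>V. vertex_degree F v \<le> r) \<and> stable_sparse (40 * ln (card V)) V F \<and>
           r ^ 4 / 64 \<le> card F - r * card (triangles V F)"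
proof -
  define p where "p = 1 / (8 * r\<^sup>2)"
  let ?M = "random_graph V p" and ?X = "\<lambda>F. card F - r * card (triangles V F)"
  let ?bad = "{F. (\<exists>v\<in>V. r \<le> vertex_degree F v) \<or> \<not> stable_sparse (40 * ln (card V)) V F}"
  have "1 \<le> 8 * r\<^sup>2"
    using r(1) one_le_power[of r 2] by linarith
  then have p: "0 < p" "p \<le> 1"
    using r(1) by (simp_all add: p_def)
  have "8 * (p * card V) = r"
    using r(1) by (simp add: n p_def field_simps eval_nat_numeral)
  have X_le: "?X F \<le> real (card V) ^ 2" if "F \<in> set_pmf ?M" for F
    using V r(1) that set_pmf_random_subset by (intro edges_minus_triangles_le) auto
  have "(real (card V) ^ 2 - r ^ 4 / 64) * measure_pmf.prob ?M ?bad
      \<le> real (card V) ^ 2 * (card V * exp (- r) + 6 / card V)"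
    using V(1) r p \<open>8 * (p * card V) = r\<close>
    by (intro mult_mono prob_large_degree_or_not_stable_sparse_le) auto
  moreover have "r ^ 4 / 48 \<le> measure_pmf.expectation ?M ?X"
    using choose_2_minus_choose_3_ge[OF n V(2) _ p_def]
      expectation_edges_minus_triangles[OF V(1), of p] p r by simp
  ultimately have "r ^ 4 / 64 + (real (card V) ^ 2 - r ^ 4 / 64) * measure_pmf.prob ?M ?bad
      < measure_pmf.expectation ?M ?X"
    using small by linarith
  with X_le have "\<exists>F\<in>set_pmf ?M - ?bad. r ^ 4 / 64 < ?X F"
    using V(1) by (intro exists_outside_event_gt integrable_random_subset finite_imp_finite_nsets)
  then obtain F where "F \<in> set_pmf ?M" "F \<notin> ?bad" "r ^ 4 / 64 < ?X F"
    by blast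
  then show ?thesis
    using set_pmf_random_subset[of "[V]\<^bsup>2\<^esup>" p] by (intro exI[of _ F]) (auto simp: not_le)
qed

section \<open>Passing to a triangle-free induced subgraph of large minimum degree\<close>

lemma card_edges_meeting_le:
  fixes D :: real
  assumes "finite F" "finite S" and deg: "\<And>v. v \<in> S \<Longrightarrow> vertex_degree F v \<le> D"
  shows "card {e \<in> F. e \<inter> S \<noteq> {}} \<le> D * card S"
proof -
  have meeting_eq: "{e \<in> F. e \<inter> S \<noteq> {}} = (\<Union>v\<in>S. {e \<in> F. v \<in> e})"
    by auto
  have "card {e \<in> F. e \<inter> S \<noteq> {}} \<le> (\<Sum>v\<in>S. vertex_degree F v)"
    unfolding meeting_eq vertex_degree_def using assms(2) by (rule card_UN_le)
  then have "real (card {e \<in> F. e \<inter> S \<noteq> {}}) \<le> (\<Sum>v\<in>S. real (vertex_degree F v))"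
    by (metis of_nat_le_iff of_nat_sum)
  also have "\<dots> \<le> (\<Sum>v\<in>S. D)"
    using deg by (intro sum_mono)
  finally show ?thesis
    by (simp add: mult.commute)
qed

lemma card_induced_edges_le:
  fixes D :: real
  assumes "finite F" "finite W" "\<And>v. v \<in> W \<Longrightarrow> vertex_degree F v \<le> D"
  shows "card (F \<inter> [W]\<^bsup>2\<^esup>) \<le> D * card W"
proof -
  have "F \<inter> [W]\<^bsup>2\<^esup> \<subseteq> {e \<in> F. e \<inter> W \<noteq> {}}"
    by (auto simp: nsets_2_eq)
  then have "card (F \<inter> [W]\<^bsup>2\<^esup>) \<le> card {e \<in> F. e \<inter> W \<noteq> {}}"
    using assms by (intro card_mono) auto
  then show ?thesis
    using card_edges_meeting_le[OF assms] by linarith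
qed

lemma exists_triangle_free_subset:
  fixes D :: real
  assumes V: "finite V" and F: "F \<subseteq> [V]\<^bsup>2\<^esup>" and deg: "\<And>v. v \<in> V \<Longrightarrow> vertex_degree F v \<le> D"
    and "0 \<le> D"
  shows "\<exists>U\<subseteq>V. triangles U F = {} \<and> card F - D * card (triangles V F) \<le> card (F \<inter> [U]\<^bsup>2\<^esup>)"
proof -
  have fin: "finite F" "finite (triangles V F)"
    using V finite_subset[OF F] by (auto simp: triangles_def finite_imp_finite_nsets)
  have "\<exists>v. v \<in> t" if "t \<in> triangles V F" for t
    using that by (auto simp: triangles_def nsets_def card_3_iff)
  then obtain f where f: "\<And>t. t \<in> triangles V F \<Longrightarrow> f t \<in> t"
    by metis
  define S where "S = f ` triangles V F"
  have "triangles (V - S) F = {}"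
  proof (rule equals0I)
    fix t assume "t \<in> triangles (V - S) F"
    then have "t \<in> triangles V F" "t \<inter> S = {}"
      by (auto simp: triangles_def nsets_def)
    then show False
      using f[of t] by (auto simp: S_def)
  qed
  moreover have "card F - D * card (triangles V F) \<le> card (F \<inter> [V - S]\<^bsup>2\<^esup>)"
  proof -
    have "F - [V - S]\<^bsup>2\<^esup> \<subseteq> {e \<in> F. e \<inter> S \<noteq> {}}"
      using F by (auto simp: nsets_def)
    then have "card (F - [V - S]\<^bsup>2\<^esup>) \<le> card {e \<in> F. e \<inter> S \<noteq> {}}"
      using fin by (intro card_mono) auto
    moreover have "v \<in> V" if "v \<in> S" for v
      using that f by (auto simp: S_def triangles_def nsets_def)
    then have "card {e \<in> F. e \<inter> S \<noteq> {}} \<le> D * card S"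
      using fin deg by (intro card_edges_meeting_le) (auto simp: S_def)
    moreover have "D * card S \<le> D * card (triangles V F)"
      unfolding S_def using fin \<open>0 \<le> D\<close> by (intro mult_left_mono of_nat_mono card_image_le)
    moreover have "card F = card (F \<inter> [V - S]\<^bsup>2\<^esup>) + card (F - [V - S]\<^bsup>2\<^esup>)"
      using fin card_Int_Diff by blast
    ultimately show ?thesis by linarith
  qed
  ultimately show ?thesis by blast
qed

lemma card_induced_edges_remove:
  assumes "finite W"
  shows "card (F \<inter> [W]\<^bsup>2\<^esup>) = card (F \<inter> [W - {v}]\<^bsup>2\<^esup>) + vertex_degree (F \<inter> [W]\<^bsup>2\<^esup>) v"
proof -
  let ?R = "F \<inter> [W - {v}]\<^bsup>2\<^esup>" and ?S = "{e \<in> F \<inter> [W]\<^bsup>2\<^esup>. v \<in> e}"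
  have "card (?R \<union> ?S) = card ?R + card ?S"
    using assms by (intro card_Un_disjoint) (auto simp: finite_imp_finite_nsets nsets_def)
  moreover have "?R \<union> ?S = F \<inter> [W]\<^bsup>2\<^esup>"
    by (auto simp: nsets_def)
  ultimately show ?thesis
    by (simp add: vertex_degree_def)
qed

text \<open>A subset maximising the number of induced edges minus \<open>d\<close> times its size has minimum
  degree at least \<open>d\<close>, as deleting a vertex of smaller degree would increase that quantity.\<close>

lemma exists_min_degree_subset:
  fixes d :: real
  assumes U: "finite U"
  shows "\<exists>W\<subseteq>U. (\<forall>v\<in>W. d \<le> vertex_degree (F \<inter> [W]\<^bsup>2\<^esup>) v) \<and>
           card (F \<inter> [U]\<^bsup>2\<^esup>) - d * card U \<le> card (F \<inter> [W]\<^bsup>2\<^esup>) - d * card W"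
proof -
  define g where "g W = real (card (F \<inter> [W]\<^bsup>2\<^esup>)) - d * card W" for W
  have fin: "finite (g ` Pow U)" "g ` Pow U \<noteq> {}"
    using U by auto
  obtain W where W: "W \<subseteq> U" "g W = Max (g ` Pow U)"
    using Max_in[OF fin] by (metis PowD imageE)
  have max: "g W' \<le> g W" if "W' \<subseteq> U" for W'
    unfolding W(2) using fin that by (intro Max_ge) auto
  have "d \<le> vertex_degree (F \<inter> [W]\<^bsup>2\<^esup>) v" if v: "v \<in> W" for v
  proof -
    have finW: "finite W"
      using W U finite_subset by blast
    have "g (W - {v}) \<le> g W"
      using W by (intro max) auto
    moreover have "real (card W) = card (W - {v}) + 1"
      using card.remove[OF finW v] by simp
    ultimately show ?thesis
      using card_induced_edges_remove[OF finW, of F v] by (simp add: g_def algebra_simps)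
  qed
  then show ?thesis
    using W(1) max[of U] by (intro exI[of _ W]) (auto simp: g_def)
qed

lemma exists_triangle_free_min_degree_subset:
  fixes D d m :: real
  assumes V: "finite V" and F: "F \<subseteq> [V]\<^bsup>2\<^esup>" and deg: "\<And>v. v \<in> V \<Longrightarrow> vertex_degree F v \<le> D"
    and "0 \<le> D" "0 \<le> d" and m: "m \<le> card F - D * card (triangles V F)"
  shows "\<exists>W\<subseteq>V. triangles W F = {} \<and> (\<forall>v\<in>W. d \<le> vertex_degree (F \<inter> [W]\<^bsup>2\<^esup>) v) \<and>
           m - d * card V \<le> D * card W"
proof -
  obtain U where U: "U \<subseteq> V" "triangles U F = {}"
    and U_edges: "card F - D * card (triangles V F) \<le> card (F \<inter> [U]\<^bsup>2\<^esup>)"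
    using exists_triangle_free_subset[OF V F deg \<open>0 \<le> D\<close>] by blast
  have "finite U"
    using U V finite_subset by blast
  then obtain W where W: "W \<subseteq> U" "\<forall>v\<in>W. d \<le> vertex_degree (F \<inter> [W]\<^bsup>2\<^esup>) v"
    and W_edges: "card (F \<inter> [U]\<^bsup>2\<^esup>) - d * card U \<le> card (F \<inter> [W]\<^bsup>2\<^esup>) - d * card W"
    using exists_min_degree_subset[of U d F] by blast
  have "finite F" "finite W"
    using finite_subset[OF F] finite_subset[OF W(1)] \<open>finite U\<close> V
    by (simp_all add: finite_imp_finite_nsets)
  then have "card (F \<inter> [W]\<^bsup>2\<^esup>) \<le> D * card W"
    using deg U W by (intro card_induced_edges_le) auto
  moreover have "d * card U \<le> d * card V"
    using \<open>0 \<le> d\<close> U V by (intro mult_left_mono of_nat_mono card_mono)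
  moreover have "0 \<le> d * card W"
    using \<open>0 \<le> d\<close> by simp
  ultimately have "m - d * card V \<le> D * card W"
    using m U_edges W_edges by linarith
  moreover have "triangles W F = {}"
    using U(2) W(1) by (auto simp: triangles_def nsets_def)
  ultimately show ?thesis
    using U W by blast
qed

lemma stable_sparse_induced:
  assumes "stable_sparse c V F" "F \<subseteq> [V]\<^bsup>2\<^esup>" "W \<subseteq> V"
  shows "stable_sparse c W (F \<inter> [W]\<^bsup>2\<^esup>)"
  unfolding stable_sparse_def
proof (intro allI impI)
  fix A B assume AB: "A \<subseteq> W" "B \<subseteq> W" "[A]\<^bsup>2\<^esup> \<inter> (F \<inter> [W]\<^bsup>2\<^esup>) = {}"
  have "[A]\<^bsup>2\<^esup> \<inter> F = {}"
    using AB(3) nsets_mono[OF AB(1)] by blast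
  moreover have "a \<noteq> b" if "{a, b} \<in> F" for a b
    using subsetD[OF assms(2) that] by simp
  then have "cross_edges (F \<inter> [W]\<^bsup>2\<^esup>) A B = cross_edges F A B"
    using AB(1,2) by (auto simp: cross_edges_def)
  ultimately show "card (cross_edges (F \<inter> [W]\<^bsup>2\<^esup>) A B) \<le> c * (card A + card B)"
    using assms AB unfolding stable_sparse_def by auto
qed

lemma exists_sparse_core:
  fixes r :: real
  assumes V: "finite V" "2 \<le> card V" and n: "real (card V) = r ^ 3"
    and r: "1 \<le> r" "1 \<le> ln (card V)"
    and small: "real (card V) ^ 2 * (card V * exp (- r) + 6 / card V) < r ^ 4 / 192"
  shows "\<exists>W\<subseteq>V. \<exists>F\<subseteq>[W]\<^bsup>2\<^esup>. card V \<le> 128 * card W \<and> triangles W F = {} \<and>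
           (\<forall>v\<in>W. r / 128 \<le> vertex_degree F v \<and> vertex_degree F v \<le> r) \<and>
           stable_sparse (40 * ln (card V)) W F"
proof -
  obtain F where F: "F \<subseteq> [V]\<^bsup>2\<^esup>" "\<And>v. v \<in> V \<Longrightarrow> vertex_degree F v \<le> r"
      "stable_sparse (40 * ln (card V)) V F" "r ^ 4 / 64 \<le> card F - r * card (triangles V F)"
    using exists_sparse_edge_set[OF assms] by blast
  have "0 \<le> r" "0 \<le> r / 128"
    using r by simp_all
  obtain W where W: "W \<subseteq> V" "triangles W F = {}"
      "\<forall>v\<in>W. r / 128 \<le> vertex_degree (F \<inter> [W]\<^bsup>2\<^esup>) v"
    and W_large: "r ^ 4 / 64 - r / 128 * card V \<le> r * card W"
    using exists_triangle_free_min_degree_subset[OF V(1) F(1,2) \<open>0 \<le> r\<close> \<open>0 \<le> r / 128\<close> F(4)] by blast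
  have "r * r ^ 3 \<le> r * (128 * card W)"
    using W_large unfolding n by (simp add: eval_nat_numeral)
  then have "card V \<le> 128 * card W"
    using r(1) unfolding n[symmetric] by simp
  moreover have "triangles W (F \<inter> [W]\<^bsup>2\<^esup>) = {}"
    using W(2) by (auto simp: triangles_def)
  moreover have "vertex_degree (F \<inter> [W]\<^bsup>2\<^esup>) v \<le> r" if "v \<in> W" for v
  proof -
    have "finite F"
      using V(1) by (intro finite_subset[OF F(1)] finite_imp_finite_nsets)
    then have "vertex_degree (F \<inter> [W]\<^bsup>2\<^esup>) v \<le> vertex_degree F v"
      unfolding vertex_degree_def by (intro card_mono) auto
    then show ?thesis
      using F(2)[of v] W(1) that by force
  qed
  ultimately show ?thesis
    using W(1,3) stable_sparse_induced[OF F(3,1) W(1)]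
    by (intro exI[of _ W] exI[of _ "F \<inter> [W]\<^bsup>2\<^esup>"] conjI) auto
qed

lemma eventually_exists_sparse_core:
  "\<forall>\<^sub>F n in sequentially. \<exists>W\<subseteq>{..<n}. \<exists>F\<subseteq>[W]\<^bsup>2\<^esup>. n \<le> 128 * card W \<and> triangles W F = {} \<and>
     (\<forall>v\<in>W. real n powr (1/3) / 128 \<le> vertex_degree F v \<and> vertex_degree F v \<le> real n powr (1/3)) \<and>
     stable_sparse (40 * ln n) W F"
proof -
  have "\<forall>\<^sub>F n in sequentially.
      real n ^ 2 * (n * exp (- (real n powr (1/3))) + 6 / n) < (real n powr (1/3)) ^ 4 / 192"
    by real_asymp
  moreover have "\<forall>\<^sub>F n in sequentially. 1 \<le> ln (real n)"
    by real_asymp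
  ultimately show ?thesis
    using eventually_ge_at_top[of 2]
  proof eventually_elim
    case (elim n)
    have "real n = (real n powr (1/3)) ^ 3" "1 \<le> real n powr (1/3)"
      using elim by (simp_all add: powr_power ge_one_powr_ge_zero)
    then show ?case
      using exists_sparse_core[of "{..<n}" "real n powr (1/3)"] elim by simp
  qed
qed

section \<open>Replacing vertices by twins\<close>

definition bounded_fibres :: "nat \<Rightarrow> 'a set \<Rightarrow> ('a \<Rightarrow> 'b) \<Rightarrow> bool" where
  "bounded_fibres k X f \<longleftrightarrow> (\<forall>a. card {x \<in> X. f x = a} \<le> k)"

lemma card_vimage_bounded_fibres_le:
  assumes "finite N" "bounded_fibres k X f"
  shows "card {x \<in> X. f x \<in> N} \<le> k * card N"
proof -
  have vimage_eq: "{x \<in> X. f x \<in> N} = (\<Union>a\<in>N. {x \<in> X. f x = a})"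
    by auto
  have "card {x \<in> X. f x \<in> N} \<le> (\<Sum>a\<in>N. card {x \<in> X. f x = a})"
    unfolding vimage_eq using assms(1) by (rule card_UN_le)
  also have "\<dots> \<le> (\<Sum>a\<in>N. k)"
    using assms(2) by (intro sum_mono) (simp add: bounded_fibres_def)
  finally show ?thesis by (simp add: mult.commute)
qed

lemma bounded_fibres_doubleton:
  assumes "finite X" and f: "bounded_fibres k X f"
  shows "bounded_fibres (2 * k\<^sup>2) (X \<times> X) (\<lambda>(u, v). {f u, f v})"
  unfolding bounded_fibres_def
proof
  fix e
  let ?fib = "\<lambda>a. {x \<in> X. f x = a}"
  have fibre: "card (?fib a \<times> ?fib b) \<le> k\<^sup>2" for a b
    using f by (simp add: bounded_fibres_def card_cartesian_product power2_eq_square mult_le_mono)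
  show "card {z \<in> X \<times> X. (case z of (u, v) \<Rightarrow> {f u, f v}) = e} \<le> 2 * k\<^sup>2"
  proof (cases "\<exists>a b. e = {a, b}")
    case True
    then obtain a b where "e = {a, b}"
      by blast
    then have "{z \<in> X \<times> X. (case z of (u, v) \<Rightarrow> {f u, f v}) = e} \<subseteq> ?fib a \<times> ?fib b \<union> ?fib b \<times> ?fib a"
      by (auto simp: doubleton_eq_iff)
    then have "card {z \<in> X \<times> X. (case z of (u, v) \<Rightarrow> {f u, f v}) = e}
        \<le> card (?fib a \<times> ?fib b \<union> ?fib b \<times> ?fib a)"
      using assms(1) by (intro card_mono) auto
    also have "\<dots> \<le> k\<^sup>2 + k\<^sup>2"
      by (intro order_trans[OF card_Un_le] add_mono fibre)
    finally show ?thesis by simp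
  next
    case False
    then have empty: "{z \<in> X \<times> X. (case z of (u, v) \<Rightarrow> {f u, f v}) = e} = {}"
      by auto
    show ?thesis
      unfolding empty by simp
  qed
qed

lemma bounded_fibres_mod:
  assumes "n \<le> m * s"
  shows "bounded_fibres m {..<n} (\<lambda>x. x mod s)"
  unfolding bounded_fibres_def
proof
  fix a
  have "inj_on (\<lambda>x. x div s) {x \<in> {..<n}. x mod s = a}"
    by (rule inj_onI) (metis (mono_tags, lifting) div_mult_mod_eq mem_Collect_eq)
  moreover have "(\<lambda>x. x div s) ` {x \<in> {..<n}. x mod s = a} \<subseteq> {..<m}"
    using assms by (auto intro: less_mult_imp_div_less)
  ultimately have "card {x \<in> {..<n}. x mod s = a} \<le> card {..<m}"
    by (intro card_inj_on_le) auto
  then show "card {x \<in> {..<n}. x mod s = a} \<le> m"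
    by simp
qed

lemma bounded_fibres_comp:
  assumes "finite X" "bounded_fibres k X g" "inj_on h (g ` X)"
  shows "bounded_fibres k X (\<lambda>x. h (g x))"
  unfolding bounded_fibres_def
proof
  fix a
  have "{x \<in> X. h (g x) = a} \<subseteq> {x \<in> X. g x = inv_into (g ` X) h a}"
    using assms(3) by auto
  then have "card {x \<in> X. h (g x) = a} \<le> card {x \<in> X. g x = inv_into (g ` X) h a}"
    using assms(1) by (intro card_mono) auto
  also have "\<dots> \<le> k"
    using assms(2) by (simp add: bounded_fibres_def)
  finally show "card {x \<in> X. h (g x) = a} \<le> k" .
qed

lemma exists_surjection_bounded_fibres:
  assumes W: "finite W" "card W \<le> n" "n \<le> m * card W"
  shows "\<exists>f. f ` {..<n} = W \<and> bounded_fibres m {..<n} f"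
proof -
  let ?g = "\<lambda>x. x mod card W"
  obtain h where h: "bij_betw h {..<card W} W"
    using ex_bij_betw_nat_finite[OF W(1)] by (auto simp: atLeast0LessThan)
  have g: "?g ` {..<n} = {..<card W}"
  proof (intro equalityI subsetI)
    show "a \<in> ?g ` {..<n}" if "a \<in> {..<card W}" for a
      using that W(2) by (intro image_eqI[of _ _ a]) auto
    show "a \<in> {..<card W}" if "a \<in> ?g ` {..<n}" for a
      using that W(3) by (cases "card W = 0") auto
  qed
  then have "h ` ?g ` {..<n} = W"
    using h by (simp add: bij_betw_def)
  then have "(\<lambda>x. h (?g x)) ` {..<n} = W"
    by (simp add: image_image)
  moreover have "bounded_fibres m {..<n} (\<lambda>x. h (?g x))"
    using h g by (intro bounded_fibres_comp[OF finite_lessThan bounded_fibres_mod[OF W(3)]])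
      (simp add: bij_betw_def)
  ultimately show ?thesis by blast
qed

definition pullback_graph :: "'b set \<Rightarrow> ('b \<Rightarrow> 'a) \<Rightarrow> 'a set set \<Rightarrow> 'b pair_pre_digraph" where
  "pullback_graph X f F = \<lparr>pverts = X, parcs = {(u, v). u \<in> X \<and> v \<in> X \<and> {f u, f v} \<in> F}\<rparr>"

lemma dominates_pullback_graph_iff:
  "u \<rightarrow>\<^bsub>with_proj (pullback_graph X f F)\<^esub> v \<longleftrightarrow> u \<in> X \<and> v \<in> X \<and> {f u, f v} \<in> F"
  by (auto simp: pullback_graph_def)

lemma pverts_pullback_graph [simp]: "pverts (pullback_graph X f F) = X"
  by (simp add: pullback_graph_def)

lemma symmetric_pullback_graph: "symmetric (with_proj (pullback_graph X f F))"
  by (auto simp: symmetric_def sym_def pullback_graph_def insert_commute)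

lemma pair_graph_pullback_graph:
  assumes "finite X" "F \<subseteq> [W]\<^bsup>2\<^esup>"
  shows "pair_graph (pullback_graph X f F)"
proof
  show "finite (parcs (pullback_graph X f F))"
    using assms by (auto simp: pullback_graph_def intro: finite_subset[of _ "X \<times> X"])
  show "symmetric (with_proj (pullback_graph X f F))"
    by (rule symmetric_pullback_graph)
  show "fst e \<noteq> snd e" if "e \<in> parcs (pullback_graph X f F)" for e
  proof -
    have edge: "{f (fst e), f (snd e)} \<in> F"
      using that by (auto simp: pullback_graph_def)
    have "f (fst e) \<noteq> f (snd e)"
      using subsetD[OF assms(2) edge] by simp
    then show ?thesis by metis
  qed
qed (use assms in \<open>auto simp: pullback_graph_def\<close>)

lemma triangle_free_pullback_graph:
  assumes F: "F \<subseteq> [W]\<^bsup>2\<^esup>" and "triangles W F = {}"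
  shows "triangle_free (with_proj (pullback_graph X f F))"
proof -
  have False if abc: "{a, b} \<in> F" "{b, c} \<in> F" "{c, a} \<in> F" for a b c
  proof -
    have "{a, b} \<in> [W]\<^bsup>2\<^esup>" "{b, c} \<in> [W]\<^bsup>2\<^esup>" "{c, a} \<in> [W]\<^bsup>2\<^esup>"
      using abc F by blast+
    then have "{a, b, c} \<subseteq> W" "card {a, b, c} = 3"
      by auto
    then have "{a, b, c} \<in> [W]\<^bsup>3\<^esup>"
      by (simp add: nsets_def)
    moreover have "[{a, b, c}]\<^bsup>2\<^esup> \<subseteq> F"
      using abc by (auto simp: nsets_2_eq insert_commute)
    ultimately show False
      using assms(2) by (auto simp: triangles_def)
  qed
  then show ?thesis
    unfolding triangle_free_def dominates_pullback_graph_iff by blast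
qed

lemma out_degree_with_proj: "out_degree (with_proj G) u = card {v. (u, v) \<in> parcs G}"
  unfolding out_degree_def out_arcs_def
  by (rule bij_betw_same_card[of snd]) (auto simp: bij_betw_def inj_on_def image_iff)

lemma out_degree_pullback_graph_bounds:
  assumes "finite X" "F \<subseteq> [W]\<^bsup>2\<^esup>" "f ` X = W" "bounded_fibres k X f" "x \<in> X"
  shows "vertex_degree F (f x) \<le> out_degree (with_proj (pullback_graph X f F)) x"
    and "out_degree (with_proj (pullback_graph X f F)) x \<le> k * vertex_degree F (f x)"
proof -
  let ?N = "{a. {a, f x} \<in> F}"
  have degree: "vertex_degree F (f x) = card ?N"
    by (rule card_neighbours_eq_vertex_degree[OF assms(2), symmetric])
  have N: "?N \<subseteq> W"
    by (auto dest!: subsetD[OF assms(2)])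
  have "finite W"
    using assms(1,3) by blast
  then have fin_N: "finite ?N"
    using N finite_subset by blast
  have N_image: "?N \<subseteq> f ` {y \<in> X. f y \<in> ?N}"
    using N assms(3) by blast
  have out_degree: "out_degree (with_proj (pullback_graph X f F)) x = card {y \<in> X. f y \<in> ?N}"
    unfolding out_degree_with_proj using \<open>x \<in> X\<close>
    by (intro arg_cong[of _ _ card]) (auto simp: pullback_graph_def insert_commute)
  show "vertex_degree F (f x) \<le> out_degree (with_proj (pullback_graph X f F)) x"
    unfolding degree out_degree using assms(1) by (intro surj_card_le[OF _ N_image]) simp
  show "out_degree (with_proj (pullback_graph X f F)) x \<le> k * vertex_degree F (f x)"
    unfolding degree out_degree using fin_N assms(4) by (rule card_vimage_bounded_fibres_le)
qed

lemma out_degree_pullback_graph_between: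
  fixes d D :: real
  assumes "finite X" "F \<subseteq> [W]\<^bsup>2\<^esup>" "f ` X = W" "bounded_fibres k X f" "x \<in> X"
    and degree: "\<forall>a\<in>W. d \<le> vertex_degree F a \<and> vertex_degree F a \<le> D"
  shows "d \<le> out_degree (with_proj (pullback_graph X f F)) x"
    and "out_degree (with_proj (pullback_graph X f F)) x \<le> k * D"
proof -
  let ?deg = "out_degree (with_proj (pullback_graph X f F)) x"
  have fx: "d \<le> vertex_degree F (f x)" "vertex_degree F (f x) \<le> D"
    using degree assms(3,5) by auto
  have "real (vertex_degree F (f x)) \<le> ?deg"
    by (intro of_nat_mono out_degree_pullback_graph_bounds(1)[OF assms(1-5)])
  then show "d \<le> ?deg"
    using fx(1) by linarith
  have "real ?deg \<le> real (k * vertex_degree F (f x))"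
    by (intro of_nat_mono out_degree_pullback_graph_bounds(2)[OF assms(1-5)])
  also have "\<dots> \<le> k * D"
    unfolding of_nat_mult using fx(2) by (intro mult_left_mono) auto
  finally show "?deg \<le> k * D" .
qed

lemma stable_image_of_stable_set_pullback_graph:
  assumes "stable_set (with_proj (pullback_graph X f F)) S"
  shows "[f ` S]\<^bsup>2\<^esup> \<inter> F = {}"
proof -
  have "S \<subseteq> X"
    using assms by (simp add: stable_set_def)
  moreover have "\<not> x \<rightarrow>\<^bsub>with_proj (pullback_graph X f F)\<^esub> y" if "x \<in> S" "y \<in> S" for x y
    using assms that by (simp add: stable_set_def)
  ultimately have "{f x, f y} \<notin> F" if "x \<in> S" "y \<in> S" for x y
    using that unfolding dominates_pullback_graph_iff by blast
  then show ?thesis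
    by (auto simp: nsets_2_eq)
qed

lemma average_degree_bipartite_between_le:
  assumes fin: "finite V1" "finite V2" and "symmetric G"
  shows "average_degree (with_proj (bipartite_between G V1 V2))
         \<le> 2 * real (card {(u, v) \<in> V1 \<times> V2. u \<rightarrow>\<^bsub>G\<^esub> v}) / card (V1 \<union> V2)"
proof -
  let ?B = "parcs (bipartite_between G V1 V2)"
  let ?E = "{(u, v) \<in> V1 \<times> V2. u \<rightarrow>\<^bsub>G\<^esub> v}"
  have finE: "finite ?E"
    using fin by (auto intro: finite_subset[of _ "V1 \<times> V2"])
  have sub: "?B \<subseteq> ?E \<union> prod.swap ` ?E"
    using \<open>symmetric G\<close> by (auto simp: bipartite_between_def image_iff symmetric_def dest: symD)
  then have finB: "finite ?B"
    using finE by (auto intro: finite_subset)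
  have "(\<Sum>v\<in>V1 \<union> V2. out_degree (with_proj (bipartite_between G V1 V2)) v) =
      card (\<Union>v\<in>V1 \<union> V2. {e \<in> ?B. fst e = v})"
    unfolding out_degree_def out_arcs_def using fin finB
    by (subst card_UN_disjoint) auto
  also have "\<dots> \<le> card (?E \<union> prod.swap ` ?E)"
    using finE sub by (intro card_mono) auto
  also have "\<dots> \<le> card ?E + card ?E"
    using card_Un_le[of ?E "prod.swap ` ?E"] card_image_le[OF finE, of prod.swap] by linarith
  finally have "(\<Sum>v\<in>V1 \<union> V2. real (out_degree (with_proj (bipartite_between G V1 V2)) v))
      \<le> 2 * card ?E"
    by (simp flip: of_nat_sum)
  then show ?thesis
    by (simp add: average_degree_def bipartite_between_def divide_right_mono)
qed

lemma card_cross_arcs_pullback_graph_le: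
  fixes c :: real
  assumes "finite X" and f: "f ` X \<subseteq> W" "bounded_fibres k X f"
    and sparse: "stable_sparse c W F" and "0 \<le> c"
    and V: "V1 \<subseteq> X" "V2 \<subseteq> X" and stable: "stable_set (with_proj (pullback_graph X f F)) V1"
  shows "card {(u, v) \<in> V1 \<times> V2. u \<rightarrow>\<^bsub>with_proj (pullback_graph X f F)\<^esub> v}
         \<le> 2 * (real k)\<^sup>2 * c * (card V1 + card V2)"
proof -
  let ?C = "cross_edges F (f ` V1) (f ` V2)"
  have fin: "finite V1" "finite V2"
    using assms finite_subset by blast+
  then have finC: "finite ?C"
    by (auto simp: cross_edges_def
        intro!: finite_subset[of _ "(\<lambda>(a, b). {a, b}) ` (f ` V1 \<times> f ` V2)"])
  have "card {(u, v) \<in> V1 \<times> V2. u \<rightarrow>\<^bsub>with_proj (pullback_graph X f F)\<^esub> v}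
      \<le> card {z \<in> X \<times> X. (case z of (u, v) \<Rightarrow> {f u, f v}) \<in> ?C}"
    using assms(1) V
    by (intro card_mono)
      (auto simp: dominates_pullback_graph_iff cross_edges_def simp del: with_proj_simps)
  also have "\<dots> \<le> 2 * k\<^sup>2 * card ?C"
    using assms(1) f(2) by (intro card_vimage_bounded_fibres_le finC bounded_fibres_doubleton)
  finally have "real (card {(u, v) \<in> V1 \<times> V2. u \<rightarrow>\<^bsub>with_proj (pullback_graph X f F)\<^esub> v})
      \<le> 2 * (real k)\<^sup>2 * card ?C"
    by (simp flip: of_nat_le_iff[where ?'a = real])
  also have "\<dots> \<le> 2 * (real k)\<^sup>2 * (c * (card (f ` V1) + card (f ` V2)))"
  proof -
    have "f ` V1 \<subseteq> W" "f ` V2 \<subseteq> W"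
      using V f(1) by blast+
    then have "card ?C \<le> c * (card (f ` V1) + card (f ` V2))"
      using sparse stable_image_of_stable_set_pullback_graph[OF stable]
      unfolding stable_sparse_def by blast
    then show ?thesis
      by (intro mult_left_mono) auto
  qed
  also have "\<dots> \<le> 2 * (real k)\<^sup>2 * (c * (card V1 + card V2))"
    using \<open>0 \<le> c\<close> fin by (intro mult_left_mono of_nat_mono add_mono card_image_le) auto
  finally show ?thesis
    by (simp add: mult.assoc)
qed

lemma not_has_semi_bipartite_induced_subgraph_pullback_graph:
  fixes c x :: real
  assumes "finite X" and f: "f ` X \<subseteq> W" "bounded_fibres k X f"
    and sparse: "stable_sparse c W F" and "0 \<le> c" and x: "4 * (real k)\<^sup>2 * c < x"
  shows "\<not> has_semi_bipartite_induced_subgraph (with_proj (pullback_graph X f F)) x"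
proof
  let ?G = "with_proj (pullback_graph X f F)"
  assume "has_semi_bipartite_induced_subgraph ?G x"
  then obtain H V1 V2 where H: "induced_subgraph H ?G" "semi_bipartition ?G H V1 V2"
    and avg: "x \<le> average_degree (with_proj (bipartite_between ?G V1 V2))"
    unfolding has_semi_bipartite_induced_subgraph_def by blast
  have "verts H \<subseteq> X"
    using H(1) by (auto simp: induced_subgraph_def subgraph_def)
  then have V: "V1 \<subseteq> X" "V2 \<subseteq> X" "V1 \<inter> V2 = {}" "stable_set ?G V1"
    using H(2) by (auto simp: semi_bipartition_def)
  have fin: "finite V1" "finite V2"
    using V assms(1) finite_subset by blast+
  note avg
  also have "average_degree (with_proj (bipartite_between ?G V1 V2))
      \<le> 2 * real (card {(u, v) \<in> V1 \<times> V2. u \<rightarrow>\<^bsub>?G\<^esub> v}) / card (V1 \<union> V2)"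
    by (rule average_degree_bipartite_between_le[OF fin symmetric_pullback_graph])
  also have "\<dots> \<le> 2 * (2 * (real k)\<^sup>2 * c * (card V1 + card V2)) / card (V1 \<union> V2)"
    by (intro divide_right_mono mult_left_mono
        card_cross_arcs_pullback_graph_le[OF assms(1-5) V(1,2,4)]) auto
  also have "card V1 + card V2 = card (V1 \<union> V2)"
    using fin V(3) by (simp add: card_Un_disjoint)
  also have "2 * (2 * (real k)\<^sup>2 * c * card (V1 \<union> V2)) / card (V1 \<union> V2) \<le> 4 * (real k)\<^sup>2 * c"
    using \<open>0 \<le> c\<close> by (cases "card (V1 \<union> V2) = 0") simp_all
  finally show False
    using x by simp
qed

lemma exists_graph_of_sparse_core:
  fixes c d D x :: real
  assumes W: "finite W" "card W \<le> n" "n \<le> m * card W"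
    and F: "F \<subseteq> [W]\<^bsup>2\<^esup>" "triangles W F = {}"
    and degree: "\<forall>a\<in>W. d \<le> vertex_degree F a \<and> vertex_degree F a \<le> D"
    and sparse: "stable_sparse c W F" "0 \<le> c" "4 * (real m)\<^sup>2 * c < x"
  shows "\<exists>G :: nat pair_pre_digraph. pair_graph G \<and> card (pverts G) = n \<and>
           triangle_free (with_proj G) \<and>
           (\<forall>v\<in>pverts G. d \<le> out_degree (with_proj G) v \<and> out_degree (with_proj G) v \<le> m * D) \<and>
           \<not> has_semi_bipartite_induced_subgraph (with_proj G) x"
proof -
  obtain f where f: "f ` {..<n} = W" "bounded_fibres m {..<n} f"
    using exists_surjection_bounded_fibres[OF W] by blast
  let ?G = "pullback_graph {..<n} f F"
  have "pair_graph ?G"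
    by (rule pair_graph_pullback_graph[OF finite_lessThan F(1)])
  moreover have "card (pverts ?G) = n"
    by simp
  moreover have "triangle_free (with_proj ?G)"
    by (rule triangle_free_pullback_graph[OF F])
  moreover have "\<forall>v\<in>pverts ?G. d \<le> out_degree (with_proj ?G) v \<and>
      out_degree (with_proj ?G) v \<le> m * D"
    using out_degree_pullback_graph_between[OF finite_lessThan F(1) f _ degree] by simp
  moreover have "\<not> has_semi_bipartite_induced_subgraph (with_proj ?G) x"
    using f(1) by (intro not_has_semi_bipartite_induced_subgraph_pullback_graph[OF
          finite_lessThan _ f(2) sparse]) simp
  ultimately show ?thesis by blast
qed

theorem theorem3p9:
  shows "\<exists>C C' C'' :: real. C > 0 \<and> C' > 0 \<and> C'' > 0 \<and>
    (\<exists>N :: nat. \<forall>n \<ge> N. \<exists>G :: nat pair_pre_digraph.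
       pair_graph G \<and> card (pverts G) = n \<and>
       triangle_free (with_proj G) \<and>
       (\<forall>v \<in> pverts G.
          C' * real n powr (1/3) \<le> real (out_degree (with_proj G) v) \<and>
          real (out_degree (with_proj G) v) \<le> C'' * real n powr (1/3)) \<and>
       \<not> has_semi_bipartite_induced_subgraph (with_proj G) (C * ln (real n)))"
proof -
  define C :: real where "C = 4 * 128\<^sup>2 * 40 + 1"
  have "\<forall>\<^sub>F n in sequentially. \<exists>G :: nat pair_pre_digraph. pair_graph G \<and> card (pverts G) = n \<and>
      triangle_free (with_proj G) \<and>
      (\<forall>v\<in>pverts G. 1/128 * real n powr (1/3) \<le> out_degree (with_proj G) v \<and>
         out_degree (with_proj G) v \<le> 128 * real n powr (1/3)) \<and>
      \<not> has_semi_bipartite_induced_subgraph (with_proj G) (C * ln (real n))"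
    using eventually_exists_sparse_core eventually_ge_at_top[of 2]
  proof eventually_elim
    case (elim n)
    then obtain W F where W: "W \<subseteq> {..<n}" "n \<le> 128 * card W"
      and F: "F \<subseteq> [W]\<^bsup>2\<^esup>" "triangles W F = {}"
      and degree: "\<forall>v\<in>W. real n powr (1/3) / 128 \<le> vertex_degree F v \<and>
        vertex_degree F v \<le> real n powr (1/3)"
      and sparse: "stable_sparse (40 * ln n) W F"
      by blast
    have "finite W" "card W \<le> n"
      using finite_subset[OF W(1)] card_mono[OF _ W(1)] by simp_all
    moreover have "0 \<le> 40 * ln (real n)" "4 * (real 128)\<^sup>2 * (40 * ln (real n)) < C * ln (real n)"
      using elim by (simp_all add: C_def)
    ultimately show ?case
      using exists_graph_of_sparse_core[OF _ _ W(2) F degree sparse] elim by simp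
  qed
  then show ?thesis
    unfolding eventually_sequentially
    by - (rule exI[of _ C], rule exI[of _ "1/128"], rule exI[of _ 128], simp add: C_def)
qed

end
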